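(* Let $y \in \mathbb{R}^n$ be fixed. For $W \in \mathbb{R}^{k\times n}$ let $x^*(W) = \arg\min_{x \in \mathbb{R}^n} \frac{1}{2}\|x-y\|_2^2 + \|Wx\|_1$ and let $c(W) = \mathrm{sign}(W x^*(W)) \in \{-1,0,1\}^k$. Suppose that $c$ is constant on an open neighbourhood of $W$. Let $W_0$ and $W_{\pm}$ be the matrices consisting of the rows of $W$ with indices $i$ such that $c(W)_i = 0$ and $c(W)_i \neq 0$, respectively, let $s$ be the vector of nonzero entries of $c(W)$, and let $P_{\mathcal{N}(W_0)} = I - W_0^{\dagger}W_0$. Then $x^*$, which is given by $x^*(W) = P_{\mathcal{N}(W_0)}(y - W_{\pm}^{\mathsf{T}} s)$, is differentiable with respect to $W$ at $W$, and its differential has the following form. With respect to $W_{\pm}$ (with $W_0$ held fixed), for a perturbation $\partial W_{\pm}$, $$\partial x^* = - P_{\mathcal{N}(W_0)}\, (\partial W_{\pm})^{\mathsf{T}} s ;$$ with respect to $W_0$ (with $W_{\pm}$ held fixed), for a perturbation $\partial W_0$, $$\partial x^* = -(C + C^{\mathsf{T}})\,(y - W_{\pm}^{\mathsf{T}} s), \qquad C = W_0^{\dagger}\, \partial W_0 \, P_{\mathcal{N}(W_0)} .$$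
   Context: The objective $x \mapsto \frac12\|x-y\|_2^2+\|Wx\|_1$ is strictly convex and has a unique global minimizer, so $x^*(W)$ is well defined. The function $\mathrm{sign}$ acts entrywise, with $\mathrm{sign}(z)_i = -1$ if $z_i<0$, $0$ if $z_i = 0$, and $1$ if $z_i>0$. $W_0^{\dagger}$ denotes the Moore-Penrose pseudoinverse, and $P_{\mathcal{N}(W_0)}$ is the orthogonal projector onto the nullspace of $W_0$. Because $c$ is constant near $W$, the partition of row indices into those of $W_0$ and those of $W_{\pm}$ is constant near $W$, so $x^*$ can be regarded locally as a function of the pair $(W_0, W_{\pm})$. Rows are kept in the same order as in $W$. If $W_0$ has no rows, $P_{\mathcal{N}(W_0)} = I$ and there is no perturbation $\partial W_0$; if $W_{\pm}$ has no rows, $W_{\pm}^{\mathsf{T}} s = 0$. *)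

theory Defs
  imports "HOL-Analysis.Analysis"
begin

definition objective :: "real^'n \<Rightarrow> real^'n^'k \<Rightarrow> real^'n \<Rightarrow> real" where
  "objective y W x = 1/2 * (norm (x - y))\<^sup>2 + (\<Sum>i\<in>UNIV. \<bar>(W *v x) $ i\<bar>)"

definition xstar :: "real^'n \<Rightarrow> real^'n^'k \<Rightarrow> real^'n" where
  "xstar y W = arg_min (objective y W) (\<lambda>_. True)"

text \<open>The sign is taken entry by entry: \<^const>\<open>sgn\<close> applied to a whole vector would instead
  normalise it to length one.\<close>

definition sign_pattern :: "real^'n \<Rightarrow> real^'n^'k \<Rightarrow> real^'k" where
  "sign_pattern y W = (\<chi> i. sgn ((W *v xstar y W) $ i))"

text \<open>The number of rows of a submatrix depends on the matrix itself, so it cannot be an index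
  type. The matrix formed by the rows with index in \<open>I\<close> is therefore represented inside
  \<open>real^'n^'k\<close>, with zero rows at the other positions, and likewise for subvectors. Matrix
  products, transposes and matrix-vector products are not affected by these zeros, and neither is
  the Moore-Penrose inverse (lemma \<open>pinv_keep_rows\<close> below). A matrix without rows is represented
  by 0.\<close>

definition keep_rows :: "'k set \<Rightarrow> real^'n^'k \<Rightarrow> real^'n^'k" where
  "keep_rows I A = (\<chi> i. if i \<in> I then A $ i else 0)"

definition keep_entries :: "'k set \<Rightarrow> real^'k \<Rightarrow> real^'k" where
  "keep_entries I v = (\<chi> i. if i \<in> I then v $ i else 0)"

definition is_pinv :: "real^'n^'m \<Rightarrow> real^'m^'n \<Rightarrow> bool" where
  "is_pinv A X \<longleftrightarrow> A ** X ** A = A \<and> X ** A ** X = X \<and>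
     transpose (A ** X) = A ** X \<and> transpose (X ** A) = X ** A"

definition pinv :: "real^'n^'m \<Rightarrow> real^'m^'n" where
  "pinv A = (THE X. is_pinv A X)"

definition null_proj :: "real^'n^'m \<Rightarrow> real^'n^'n" where
  "null_proj A = mat 1 - pinv A ** A"

lemma is_pinv_unique:
  assumes "is_pinv A X" "is_pinv A Y"
  shows "X = Y"
proof -
  have x: "A ** X ** A = A" "X ** A ** X = X" "transpose (A ** X) = A ** X"
      "transpose (X ** A) = X ** A"
    and y: "A ** Y ** A = A" "Y ** A ** Y = Y" "transpose (A ** Y) = A ** Y"
      "transpose (Y ** A) = Y ** A"
    using assms by (auto simp: is_pinv_def)
  have 1: "A ** X = A ** Y"
  proof -
    have "A ** X = transpose ((A ** Y ** A) ** X)" using x(3) y(1) by simp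
    also have "\<dots> = transpose (A ** X) ** transpose (A ** Y)"
      by (metis matrix_mul_assoc matrix_transpose_mul)
    also have "\<dots> = A ** Y" using x(1,3) y(3) by (simp add: matrix_mul_assoc)
    finally show ?thesis .
  qed
  have 2: "X ** A = Y ** A"
  proof -
    have "X ** A = transpose (X ** (A ** Y ** A))" using x(4) y(1) by simp
    also have "\<dots> = transpose (Y ** A) ** transpose (X ** A)"
      by (metis matrix_mul_assoc matrix_transpose_mul)
    also have "\<dots> = Y ** (A ** X ** A)" using x(4) y(4) by (simp add: matrix_mul_assoc)
    also have "\<dots> = Y ** A" using x(1) by simp
    finally show ?thesis .
  qed
  have "X = X ** (A ** X)" using x(2) by (simp add: matrix_mul_assoc)
  also have "\<dots> = Y ** A ** Y" using 1 2 by (simp add: matrix_mul_assoc)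
  finally show ?thesis using y(2) by simp
qed

lemma pinv_eqI: "is_pinv A X \<Longrightarrow> pinv A = X"
  unfolding pinv_def using is_pinv_unique by blast

text \<open>If the rows with index in \<open>range f\<close> are collected in a matrix of their own, indexed by
  \<open>'p\<close>, then the pseudoinverse of the padded matrix is the pseudoinverse of that matrix, padded
  with zero columns.\<close>

lemma pinv_keep_rows:
  fixes A :: "real^'n^'k" and f :: "'p::finite \<Rightarrow> 'k" and X :: "real^'p^'n"
  assumes f: "inj f" and X: "is_pinv (\<chi> a. A $ f a) X"
  shows "pinv (\<chi> a. A $ f a) = X"
    and "pinv (keep_rows (range f) A)
           = (\<chi> j i. if i \<in> range f then X $ j $ inv f i else 0)"
proof -
  let ?S = "(\<chi> a. A $ f a) :: real^'n^'p"
  let ?K = "keep_rows (range f) A"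
  let ?X = "(\<chi> j i. if i \<in> range f then X $ j $ inv f i else 0) :: real^'k^'n"
  show "pinv ?S = X" using X by (rule pinv_eqI)
  have sum_f: "(\<Sum>i\<in>UNIV. if i \<in> range f then g i else 0) = (\<Sum>a\<in>UNIV. g (f a))"
    for g :: "'k \<Rightarrow> real"
  proof -
    have "(\<Sum>i\<in>UNIV. if i \<in> range f then g i else 0) = (\<Sum>i\<in>range f. g i)"
      by (simp add: sum.If_cases)
    also have "\<dots> = (\<Sum>a\<in>UNIV. g (f a))" using f by (simp add: sum.reindex)
    finally show ?thesis .
  qed
  have XA: "?X ** ?K = X ** ?S"
  proof -
    have "(?X ** ?K) $ j $ l = (X ** ?S) $ j $ l" for j l
    proof -
      have "(?X ** ?K) $ j $ l
          = (\<Sum>i\<in>UNIV. if i \<in> range f then X $ j $ inv f i * A $ i $ l else 0)"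
        by (auto simp: matrix_matrix_mult_def keep_rows_def intro!: sum.cong)
      also have "\<dots> = (\<Sum>a\<in>UNIV. X $ j $ inv f (f a) * A $ f a $ l)" by (rule sum_f)
      finally show ?thesis using f by (simp add: matrix_matrix_mult_def)
    qed
    then show ?thesis by (simp add: vec_eq_iff)
  qed
  have AX: "(?K ** ?X) $ i $ j
      = (if i \<in> range f \<and> j \<in> range f then (?S ** X) $ inv f i $ inv f j else 0)" for i j
    using f by (auto simp: matrix_matrix_mult_def keep_rows_def)
  have KM: "keep_rows (range f) A ** M = (\<chi> i. if i \<in> range f then (?S ** M) $ inv f i else 0)"
    for M :: "real^'n^'n"
    using f by (auto simp: vec_eq_iff matrix_matrix_mult_def keep_rows_def)
  have MX: "M ** ?X = (\<chi> j i. if i \<in> range f then (M ** X) $ j $ inv f i else 0)"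
    for M :: "real^'n^'n"
    by (auto simp: vec_eq_iff matrix_matrix_mult_def)
  have pen: "?S ** X ** ?S = ?S" "X ** ?S ** X = X" "transpose (?S ** X) = ?S ** X"
      "transpose (X ** ?S) = X ** ?S"
    using X by (auto simp: is_pinv_def)
  have "?K ** ?X ** ?K = ?K ** (X ** ?S)"
    by (simp only: XA matrix_mul_assoc[symmetric])
  also have "\<dots> = ?K"
    unfolding KM using f by (auto simp: vec_eq_iff matrix_mul_assoc pen(1) keep_rows_def)
  finally have p1: "?K ** ?X ** ?K = ?K" .
  have "?X ** ?K ** ?X = (X ** ?S) ** ?X" by (simp only: XA)
  also have "\<dots> = (\<chi> j i. if i \<in> range f then (X ** ?S ** X) $ j $ inv f i else 0)" by (rule MX)
  also have "\<dots> = ?X" by (simp only: pen(2))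
  finally have p2: "?X ** ?K ** ?X = ?X" .
  have sym: "(?S ** X) $ a $ b = (?S ** X) $ b $ a" for a b
    using arg_cong[OF pen(3), of "\<lambda>M. M $ b $ a"] by (simp add: transpose_def)
  have p3: "transpose (?K ** ?X) = ?K ** ?X"
  proof -
    have "transpose (?K ** ?X) $ i $ j = (?K ** ?X) $ i $ j" for i j
    proof -
      have "transpose (?K ** ?X) $ i $ j = (?K ** ?X) $ j $ i" by (simp add: transpose_def)
      then show ?thesis unfolding AX using sym by auto
    qed
    then show ?thesis by (simp add: vec_eq_iff)
  qed
  have "is_pinv ?K ?X"
    unfolding is_pinv_def
  proof (intro conjI)
    show "transpose (?X ** ?K) = ?X ** ?K" unfolding XA by (rule pen(4))
  qed (rule p1 p2 p3)+
  then show "pinv ?K = ?X" by (rule pinv_eqI)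
qed

end

theory Submission
  imports Defs
begin

text \<open>By duality, \<open>x = xstar y V\<close> is characterized by \<open>y - x = V\<^sup>T g\<close> for a multiplier \<open>g\<close> in the unit
  cube with \<open>g\<^sub>i = sgn (V x)\<^sub>i\<close> wherever \<open>(V x)\<^sub>i \<noteq> 0\<close>. With a constant sign pattern \<open>c\<close> this
  reads \<open>y - x = V\<^sup>T (c + q)\<close> with \<open>q\<close> bounded and supported on the zero rows. Subtracting the
  conditions at \<open>V = W + H\<close> and at \<open>W\<close>, and writing \<open>A\<close>, \<open>H\<^sub>0\<close> for the zero rows of \<open>W\<close>, \<open>H\<close>,
  \<open>X\<close> for the pseudoinverse of \<open>A\<close> and \<open>P\<close> for the projector onto its nullspace, gives the exact
  identity \<open>x(V) - x(W) = - X H\<^sub>0 x(V) - P H\<^sup>T c - P H\<^sub>0\<^sup>T q(V)\<close>. Hence \<open>x\<close> is Lipschitz at \<open>W\<close>, and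
  the remainder of the claimed derivative is quadratic provided that \<open>P = 0\<close> or \<open>q\<close> is Lipschitz.
  The latter holds if \<open>A\<close> has full row rank. If \<open>A\<close> is deficient in both ranks, boundedness of \<open>q\<close> on
  suitable rank one perturbations of \<open>W\<close> forces \<open>y = 0\<close>, where everything vanishes.\<close>

section \<open>Existence of the Moore-Penrose pseudoinverse\<close>

lemma matrix_diff_ldistrib:
  fixes A :: "real^'n^'m"
  shows "A ** (B - C) = A ** B - A ** C"
  by (vector matrix_matrix_mult_def sum_subtractf right_diff_distrib)

lemma ex_generalized_inverse:
  fixes A :: "real^'n^'m"
  shows "\<exists>M. A ** M ** A = A"
proof -
  obtain g where g: "linear g" "\<forall>v\<in>range ((*v) A). A *v g v = v"
    using linear_exists_right_inverse_on[OF matrix_vector_mul_linear subspace_UNIV, of A] by blast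
  have "(A ** matrix g ** A) *v x = A *v x" for x
    using g by (simp add: matrix_vector_mul_assoc[symmetric] matrix_works)
  then show ?thesis
    using matrix_eq by blast
qed

text \<open>The Gram matrix has the same kernel as \<open>A\<close>, because the squared norm of
  \<open>A N x\<close> is the inner product of \<open>transpose A A N x\<close> with
  \<open>N x\<close>.\<close>

lemma gram_left_cancel:
  fixes A :: "real^'n^'m" and N :: "real^'l^'n"
  assumes "transpose A ** A ** N = 0"
  shows "A ** N = 0"
proof -
  have "A *v (N *v x) = 0" for x
  proof -
    have "(A *v (N *v x)) \<bullet> (A *v (N *v x)) = ((A *v (N *v x)) v* A) \<bullet> (N *v x)"
      by (simp add: dot_lmul_matrix)
    also have "(A *v (N *v x)) v* A = (transpose A ** A ** N) *v x"
      by (simp add: matrix_vector_mul_assoc[symmetric])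
    finally show ?thesis
      using assms by simp
  qed
  then show ?thesis
    by (simp add: matrix_eq matrix_vector_mul_assoc[symmetric])
qed

text \<open>For any generalized inverse \<open>M\<close> of the Gram matrix,
  \<open>A M transpose A\<close> is the orthogonal projector onto the range of
  \<open>A\<close>.\<close>

lemma ex_range_projection:
  fixes A :: "real^'n^'m"
  shows "\<exists>M. A ** M ** transpose A ** A = A \<and>
    transpose (A ** M ** transpose A) = A ** M ** transpose A"
proof -
  obtain M where M: "(transpose A ** A) ** M ** (transpose A ** A) = transpose A ** A"
    using ex_generalized_inverse by blast
  have "transpose A ** A ** (M ** transpose A ** A - mat 1) = 0"
    using M by (simp add: matrix_diff_ldistrib matrix_mul_assoc)
  then have "A ** (M ** transpose A ** A - mat 1) = 0"
    by (rule gram_left_cancel)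
  then have 1: "A ** M ** transpose A ** A = A"
    by (simp add: matrix_diff_ldistrib matrix_mul_assoc)
  have 2: "transpose A ** A ** transpose M ** transpose A = transpose A"
    using arg_cong[OF 1, of transpose] by (simp add: matrix_transpose_mul matrix_mul_assoc)
  have 3: "A ** M ** transpose A = A ** M ** (transpose A ** A ** transpose M ** transpose A)"
    by (simp only: 2)
  also have "\<dots> = (A ** M ** transpose A ** A) ** transpose M ** transpose A"
    by (simp add: matrix_mul_assoc)
  also have "\<dots> = transpose (A ** M ** transpose A)"
    by (simp add: 1 matrix_transpose_mul matrix_mul_assoc)
  finally show ?thesis
    using 1 by auto
qed

lemma ex_pinv:
  fixes A :: "real^'n^'m"
  shows "\<exists>X. is_pinv A X"
proof -
  obtain M where M: "A ** M ** transpose A ** A = A"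
      "transpose (A ** M ** transpose A) = A ** M ** transpose A"
    using ex_range_projection[of A] by blast
  obtain N where N: "transpose A ** N ** A ** transpose A = transpose A"
      "transpose (transpose A ** N ** A) = transpose A ** N ** A"
    using ex_range_projection[of "transpose A"] by auto
  have N1: "A ** transpose A ** N ** A = A"
    using arg_cong[OF N(1), of transpose] N(2)
    by (metis matrix_mul_assoc matrix_transpose_mul transpose_transpose)
  \<comment> \<open>With the range projectors \<open>A M transpose A\<close> of \<open>A\<close> and
    \<open>transpose A N A\<close> of its transpose, this choice makes \<open>A X\<close> the former
    and \<open>X A\<close> the latter.\<close>
  define X where "X = transpose A ** N ** A ** M ** transpose A"
  have AX: "A ** X = A ** M ** transpose A"
    by (simp add: X_def matrix_mul_assoc N1)
  have "X ** A = transpose A ** N ** (A ** M ** transpose A ** A)"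
    by (simp add: X_def matrix_mul_assoc)
  then have XA: "X ** A = transpose A ** N ** A"
    by (simp add: M)
  have "X ** A ** X = (transpose A ** N ** A ** transpose A) ** N ** A ** M ** transpose A"
    by (simp only: XA) (simp add: X_def matrix_mul_assoc)
  then have "X ** A ** X = X"
    by (simp only: N(1)) (simp add: X_def)
  then have "is_pinv A X"
    unfolding is_pinv_def using AX XA M N by (simp add: matrix_mul_assoc)
  then show ?thesis ..
qed

lemma is_pinv_pinv: "is_pinv A (pinv A)"
  using ex_pinv pinv_eqI by metis

section \<open>Identities for the pseudoinverse and the nullspace projector\<close>

lemma vector_matrix_symmetric: "transpose M = M \<Longrightarrow> x v* M = M *v x"
  for M :: "real^'n^'n"
  by (simp add: transpose_matrix_vector[symmetric] del: transpose_matrix_vector)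

lemma pinv_apply:
  shows "A *v (pinv A *v (A *v x)) = A *v x"
    and "(u v* A) v* pinv A = A *v (pinv A *v u)"
    and "(x v* pinv A) v* A = pinv A *v (A *v x)"
  using is_pinv_pinv[of A] unfolding is_pinv_def
  by (simp_all add: matrix_vector_mul_assoc vector_matrix_mul_assoc vector_matrix_symmetric
      matrix_mul_assoc)

text \<open>A multiplier may be replaced by its orthogonal projection onto the range of
  \<open>A\<close> without changing its image under the transpose.\<close>

lemma vector_matrix_pinv: "(A *v (pinv A *v u)) v* A = u v* A"
proof -
  have "(A *v (pinv A *v u)) v* A = ((u v* A) v* pinv A) v* A"
    by (simp only: pinv_apply)
  also have "\<dots> = u v* (A ** pinv A ** A)"
    by (simp only: vector_matrix_mul_assoc)
  also have "A ** pinv A ** A = A"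
    using is_pinv_pinv[of A] by (simp add: is_pinv_def)
  finally show ?thesis .
qed

lemma pinv_matrix_vector: "pinv A *v (A *v (u v* A)) = u v* A"
  by (simp only: pinv_apply(3)[symmetric] pinv_apply(2) vector_matrix_pinv)

lemma vector_pinv_eq_0:
  assumes "A *v x = 0"
  shows "x v* pinv A = 0"
proof -
  have "x v* pinv A = x v* (pinv A ** A ** pinv A)"
    using is_pinv_pinv[of A] by (simp add: is_pinv_def)
  also have "\<dots> = ((x v* pinv A) v* A) v* pinv A"
    by (simp only: vector_matrix_mul_assoc)
  also have "\<dots> = 0"
    by (simp add: pinv_apply assms)
  finally show ?thesis .
qed

lemma null_proj_apply: "null_proj A *v x = x - pinv A *v (A *v x)"
  by (simp add: null_proj_def matrix_vector_mult_diff_rdistrib matrix_vector_mul_assoc)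

lemma null_proj_vector_matrix: "null_proj A *v (u v* A) = 0"
  by (simp add: null_proj_apply pinv_matrix_vector)

lemma matrix_null_proj: "A *v (null_proj A *v x) = 0"
  by (simp add: null_proj_apply matrix_vector_mult_diff_distrib pinv_apply)

lemma vector_null_proj: "x v* null_proj A = null_proj A *v x"
proof -
  have "transpose (null_proj A) = null_proj A"
    using is_pinv_pinv[of A]
    by (simp add: is_pinv_def null_proj_def transpose_def vec_eq_iff mat_def eq_commute)
  then show ?thesis
    by (rule vector_matrix_symmetric)
qed

text \<open>The norm of a matrix is the Frobenius norm here, so Cauchy-Schwarz in each row
  suffices.\<close>

lemma norm_matrix_vector_mult_le:
  fixes A :: "real^'n^'m"
  shows "norm (A *v x) \<le> norm A * norm x"
proof -
  have "norm (A *v x) \<le> norm ((\<chi> i. norm (A $ i) * norm x) :: real^'m)"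
    by (rule norm_le_componentwise_cart) (simp add: matrix_vector_mul_component Cauchy_Schwarz_ineq2)
  also have "\<dots> = norm A * norm x"
    by (simp add: norm_vec_def L2_set_left_distrib[symmetric])
  finally show ?thesis .
qed

lemma norm_transpose: "norm (transpose A) = norm (A :: real^'n^'m)"
  unfolding norm_eq_sqrt_inner by (simp add: inner_vec_def transpose_def) (rule sum.swap)

lemma norm_vector_matrix_mult_le:
  fixes A :: "real^'n^'m"
  shows "norm (x v* A) \<le> norm A * norm x"
  using norm_matrix_vector_mult_le[of "transpose A" x] by (simp add: norm_transpose)

section \<open>Duality and optimality conditions for the minimizer\<close>

lemma convex_vec_box: "convex {g :: real^'k. \<forall>i. \<bar>g $ i\<bar> \<le> 1}"
  and compact_vec_box: "compact {g :: real^'k. \<forall>i. \<bar>g $ i\<bar> \<le> 1}"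
proof -
  have "{g :: real^'k. \<forall>i. \<bar>g $ i\<bar> \<le> 1} = cbox (\<chi> i. -1) (\<chi> i. 1)"
    by (auto simp: mem_box_cart abs_le_iff minus_le_iff)
  then show "convex {g :: real^'k. \<forall>i. \<bar>g $ i\<bar> \<le> 1}" "compact {g :: real^'k. \<forall>i. \<bar>g $ i\<bar> \<le> 1}"
    by (auto simp: convex_box)
qed

text \<open>The multiplier \<open>g\<close> solves the dual problem: \<open>g v* V\<close> is the point of the image of the unit
  cube that is closest to \<open>y\<close>.\<close>

lemma xstar_multiplier:
  fixes y :: "real^'n" and V :: "real^'n^'k"
  obtains g where "\<forall>i. \<bar>g $ i\<bar> \<le> 1"
    "\<forall>i. (V *v xstar y V) $ i * g $ i = \<bar>(V *v xstar y V) $ i\<bar>"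
    "y - xstar y V = g v* V"
proof -
  define B where "B = {g :: real^'k. \<forall>i. \<bar>g $ i\<bar> \<le> 1}"
  define S where "S = (\<lambda>g. g v* V) ` B"
  have lin: "linear (\<lambda>g. g v* V)"
    using matrix_vector_mul_linear[of "transpose V"] by simp
  have S: "convex S" "compact S" "S \<noteq> {}"
  proof -
    show "convex S" "compact S"
      unfolding S_def B_def using lin
      by (auto intro!: convex_linear_image convex_vec_box compact_continuous_image compact_vec_box
          linear_continuous_on simp: linear_linear)
    have "0 \<in> B" by (simp add: B_def)
    then show "S \<noteq> {}" by (auto simp: S_def)
  qed
  then have cS: "closed S" by (simp add: compact_imp_closed)
  have "closest_point S y \<in> S" by (rule closest_point_in_set[OF cS S(3)])
  then obtain g where g: "g \<in> B" "closest_point S y = g v* V"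
    by (auto simp: S_def)
  define x where "x = y - g v* V"
  have gb: "\<bar>g $ i\<bar> \<le> 1" for i using g by (simp add: B_def)
  \<comment> \<open>This is the variational inequality of the projection onto \<open>S\<close>:
    \<open>g\<close> maximizes the pairing with \<open>V *v x\<close> over the cube.\<close>
  have opt: "h \<bullet> (V *v x) \<le> g \<bullet> (V *v x)" if "h \<in> B" for h
  proof -
    have "h v* V \<in> S" using that by (auto simp: S_def)
    from closest_point_dot[OF S(1) cS this, of y]
    have "x \<bullet> (h v* V - g v* V) \<le> 0" by (simp add: g x_def)
    then show ?thesis
      by (simp add: dot_lmul_matrix inner_diff_right inner_commute[of x])
  qed
  have le: "h $ i * (V *v u) $ i \<le> \<bar>(V *v u) $ i\<bar>" if "h \<in> B" for h u i
  proof -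
    have "h $ i * (V *v u) $ i \<le> \<bar>h $ i\<bar> * \<bar>(V *v u) $ i\<bar>"
      by (metis abs_ge_self abs_mult)
    also have "\<dots> \<le> \<bar>(V *v u) $ i\<bar>"
      using that by (simp add: B_def mult_left_le_one_le)
    finally show ?thesis .
  qed
  have eq: "g $ i * (V *v x) $ i = \<bar>(V *v x) $ i\<bar>" for i
  proof -
    \<comment> \<open>The sign vector attains the l1 norm of \<open>V *v x\<close>. By maximality so
      does \<open>g\<close>, and the entrywise bounds then all have to be equalities.\<close>
    let ?h = "(\<chi> i. sgn ((V *v x) $ i)) :: real^'k"
    have "?h \<in> B" by (auto simp: B_def sgn_real_def)
    from opt[OF this] have "(\<Sum>i\<in>UNIV. \<bar>(V *v x) $ i\<bar>) \<le> (\<Sum>i\<in>UNIV. g $ i * (V *v x) $ i)"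
      by (simp add: inner_vec_def abs_sgn mult.commute)
    with sum_mono[of UNIV "\<lambda>i. g $ i * (V *v x) $ i" "\<lambda>i. \<bar>(V *v x) $ i\<bar>"] le[OF g(1)]
    have "(\<Sum>i\<in>UNIV. \<bar>(V *v x) $ i\<bar> - g $ i * (V *v x) $ i) = 0"
      by (simp add: sum_subtractf)
    then show ?thesis
      using le[OF g(1)] by (subst (asm) sum_nonneg_eq_0_iff) auto
  qed
  \<comment> \<open>The quadratic term comes from strong convexity. It makes the minimizer unique
    and thereby identifies the value of \<open>arg_min\<close> with \<open>x\<close>.\<close>
  have growth: "objective y V x + 1/2 * (norm (u - x))\<^sup>2 \<le> objective y V u" for u
  proof -
    have "(\<Sum>i\<in>UNIV. \<bar>(V *v u) $ i\<bar>) - (\<Sum>i\<in>UNIV. \<bar>(V *v x) $ i\<bar>) \<ge> g \<bullet> (V *v u) - g \<bullet> (V *v x)"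
      using sum_mono[of UNIV "\<lambda>i. g $ i * (V *v u) $ i" "\<lambda>i. \<bar>(V *v u) $ i\<bar>"] le[OF g(1)]
      by (simp add: inner_vec_def eq)
    moreover have "g \<bullet> (V *v u) - g \<bullet> (V *v x) = (y - x) \<bullet> (u - x)"
      by (simp add: x_def inner_diff_right dot_lmul_matrix matrix_vector_mult_diff_distrib)
    moreover have "1/2 * (norm (u - y))\<^sup>2
        = 1/2 * (norm (x - y))\<^sup>2 + 1/2 * (norm (u - x))\<^sup>2 - (y - x) \<bullet> (u - x)"
      by (simp add: power2_norm_eq_inner inner_diff_left inner_diff_right inner_commute
          algebra_simps)
    ultimately show ?thesis
      unfolding objective_def by linarith
  qed
  have "objective y V (xstar y V) = objective y V x"
    unfolding xstar_def
  proof (rule arg_min_equality)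
    show "objective y V x \<le> objective y V u" for u
      using growth[of u] zero_le_power2[of "norm (u - x)"] by linarith
  qed simp
  then have "xstar y V = x"
    using growth[of "xstar y V"] by simp
  with that[of g] show ?thesis
    using gb eq by (simp add: x_def mult.commute)
qed

text \<open>Pairing the optimality condition with the minimizer \<open>x\<close> gives the l1 norm
  of \<open>V *v x\<close>, which is nonnegative; then apply Cauchy-Schwarz. The bound is uniform in
  \<open>V\<close>.\<close>

lemma norm_xstar_le: "norm (xstar y V) \<le> norm y"
proof -
  let ?x = "xstar y V"
  obtain g where "\<forall>i. \<bar>g $ i\<bar> \<le> 1"
    and g: "\<forall>i. (V *v ?x) $ i * g $ i = \<bar>(V *v ?x) $ i\<bar>" "y - ?x = g v* V"
    by (rule xstar_multiplier[of V y])
  have "(y - ?x) \<bullet> ?x = (\<Sum>i\<in>UNIV. \<bar>(V *v ?x) $ i\<bar>)"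
    unfolding g(2) dot_lmul_matrix using g(1) by (simp add: inner_vec_def mult.commute)
  then have "0 \<le> (y - ?x) \<bullet> ?x" by (simp add: sum_nonneg)
  then have "norm ?x * norm ?x \<le> y \<bullet> ?x"
    by (simp add: inner_diff_left power2_norm_eq_inner[symmetric] power2_eq_square)
  also have "\<dots> \<le> norm y * norm ?x" by (rule norm_cauchy_schwarz)
  finally show ?thesis
    by (cases "?x = 0") auto
qed

section \<open>Row selection, rank one matrices and small perturbations\<close>

lemma keep_rows_matrix_vector: "keep_rows I V *v x = keep_entries I (V *v x)"
  by (simp add: vec_eq_iff keep_rows_def keep_entries_def matrix_vector_mul_component)

lemma keep_entries_vector_matrix: "keep_entries I q v* V = q v* keep_rows I V"
  by (auto simp: vec_eq_iff keep_rows_def keep_entries_def vector_matrix_mult_def intro!: sum.cong)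

lemma keep_entries_idem: "keep_entries I (keep_entries I q) = keep_entries I q"
  by (simp add: vec_eq_iff keep_entries_def)

lemma keep_entries_diff: "keep_entries I (p - q) = keep_entries I p - keep_entries I q"
  by (simp add: vec_eq_iff keep_entries_def)

lemma keep_rows_add: "keep_rows I (V + H) = keep_rows I V + keep_rows I H"
  by (simp add: vec_eq_iff keep_rows_def)

lemma linear_keep_rows: "linear (keep_rows I)"
  by (rule linearI) (simp_all add: vec_eq_iff keep_rows_def)

lemma norm_keep_rows_le: "norm (keep_rows I H) \<le> norm H"
  by (rule norm_le_componentwise_cart) (simp add: keep_rows_def)

definition outer_product :: "real^'m \<Rightarrow> real^'n \<Rightarrow> real^'n^'m" where
  "outer_product r u = (\<chi> i. r $ i *\<^sub>R u)"

lemma vector_outer_product: "q v* outer_product r u = (q \<bullet> r) *\<^sub>R u"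
  by (simp add: vec_eq_iff outer_product_def vector_matrix_mult_def inner_vec_def
      sum_distrib_left mult_ac)

lemma vector_matrix_scaleR: "q v* (t *\<^sub>R M) = t *\<^sub>R (q v* M)"
  for M :: "real^'n^'m"
  by (simp add: vec_eq_iff vector_matrix_mult_def sum_distrib_left mult_ac)

lemma matrix_scaleR_vector: "(t *\<^sub>R M) *v x = t *\<^sub>R (M *v x)"
  for M :: "real^'n^'m"
  by (simp add: vec_eq_iff matrix_vector_mul_component)

text \<open>The condition on \<open>b\<close> serves to contradict an equation
  \<open>t * a = 1\<close> in which \<open>a\<close> is bounded by \<open>b\<close> independently of
  \<open>t\<close>.\<close>

lemma open_small_step:
  fixes V M :: "'a::real_normed_vector" and b :: real
  assumes "open U" "V \<in> U"
  obtains t :: real where "t > 0" "V + t *\<^sub>R M \<in> U" "t * b < 1"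
proof -
  have "((\<lambda>t. V + t *\<^sub>R M) \<longlongrightarrow> V + 0 *\<^sub>R M) (at_right (0::real))"
    by (intro tendsto_intros)
  then have "\<forall>\<^sub>F t in at_right (0::real). V + t *\<^sub>R M \<in> U"
    using assms by (intro topological_tendstoD) auto
  moreover have "((\<lambda>t. t * b) \<longlongrightarrow> 0 * b) (at_right (0::real))"
    by (intro tendsto_intros)
  then have "\<forall>\<^sub>F t in at_right (0::real). t * b < 1"
    by (intro order_tendstoD(2)) auto
  moreover have "\<forall>\<^sub>F t in at_right (0::real). t > 0"
    by (rule eventually_at_right_less)
  ultimately have "\<forall>\<^sub>F t in at_right (0::real). t > 0 \<and> V + t *\<^sub>R M \<in> U \<and> t * b < 1"
    by eventually_elim auto
  from eventually_happens'[OF trivial_limit_at_right_real this] show ?thesis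
    using that by blast
qed

lemma has_derivative_quadratic_remainder:
  fixes f :: "'a::real_normed_vector \<Rightarrow> 'b::real_normed_vector"
  assumes L: "bounded_linear L" and S: "open S" "x \<in> S"
    and rem: "\<And>v. v \<in> S \<Longrightarrow> norm (f v - f x - L (v - x)) \<le> K * (norm (v - x))\<^sup>2"
  shows "(f has_derivative L) (at x)"
proof -
  obtain e where e: "e > 0" "ball x e \<subseteq> S"
    using S open_contains_ball by blast
  show ?thesis
  proof (rule has_derivativeI_sandwich[where e = e and H = "\<lambda>v. K * norm (v - x)"])
    fix v assume v: "v \<noteq> x" "dist v x < e"
    then have "v \<in> S" using e by (auto simp: dist_commute)
    from rem[OF this] show "norm (f v - f x - L (v - x)) / norm (v - x) \<le> K * norm (v - x)"
      using v by (simp add: divide_simps power2_eq_square mult_ac)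
  next
    have "((\<lambda>v. K * norm (v - x)) \<longlongrightarrow> K * norm (x - x)) (at x)"
      by (intro tendsto_intros)
    then show "((\<lambda>v. K * norm (v - x)) \<longlongrightarrow> 0) (at x)" by simp
  qed (use e L in auto)
qed

section \<open>Multipliers under a constant sign pattern\<close>

locale constant_sign_pattern =
  fixes y :: "real^'n" and U :: "(real^'n^'k) set" and c :: "real^'k"
  assumes open_U: "open U" and pattern: "V \<in> U \<Longrightarrow> sign_pattern y V = c"
begin

definition Z :: "'k set" where
  "Z = {i. c $ i = 0}"

lemma pattern_component: "V \<in> U \<Longrightarrow> c $ i = sgn ((V *v xstar y V) $ i)"
  using pattern[of V] by (auto simp: sign_pattern_def)

lemma feasible: "V \<in> U \<Longrightarrow> keep_rows Z V *v xstar y V = 0"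
  by (auto simp: vec_eq_iff keep_rows_matrix_vector keep_entries_def Z_def pattern_component sgn_0_0)

text \<open>Off \<open>Z\<close> the dual multiplier is forced to equal \<open>c\<close>; on
  \<open>Z\<close>, where \<open>c\<close> vanishes, it is only known to lie in the cube, and this
  part is \<open>q\<close>. The crude bound through the l1 norm does not depend on
  \<open>V\<close>.\<close>

lemma multiplier:
  assumes "V \<in> U"
  obtains q where "keep_entries Z q = q" "norm q \<le> CARD('k)"
    "y = xstar y V + c v* V + q v* V"
proof -
  obtain g where g: "\<forall>i. \<bar>g $ i\<bar> \<le> 1"
      "\<forall>i. (V *v xstar y V) $ i * g $ i = \<bar>(V *v xstar y V) $ i\<bar>"
      "y - xstar y V = g v* V"
    by (rule xstar_multiplier[of V y])
  define q where "q = keep_entries Z g"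
  have "g $ i = c $ i + q $ i" for i
  proof (cases "i \<in> Z")
    case True
    then show ?thesis by (simp add: q_def keep_entries_def Z_def)
  next
    case False
    then have "(V *v xstar y V) $ i \<noteq> 0"
      by (auto simp: Z_def pattern_component[OF assms])
    then have "g $ i = c $ i"
      using g(2)[rule_format, of i] by (simp add: abs_sgn pattern_component[OF assms])
    then show ?thesis
      using False by (simp add: q_def keep_entries_def)
  qed
  then have gq: "g = c + q" by (simp add: vec_eq_iff)
  have "norm q \<le> (\<Sum>i\<in>UNIV. \<bar>q $ i\<bar>)" by (rule norm_le_l1_cart)
  also have "\<dots> \<le> (\<Sum>i\<in>(UNIV::'k set). 1)"
    by (rule sum_mono) (simp add: q_def keep_entries_def g)
  finally have "norm q \<le> CARD('k)" by simp
  moreover have "y = xstar y V + c v* V + q v* V"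
    using g(3) by (simp add: gq vector_matrix_left_distrib algebra_simps)
  ultimately show ?thesis
    using that[of q] by (simp add: q_def keep_entries_idem)
qed

lemma multiplier_orthogonal:
  assumes "V \<in> U" "keep_entries Z q = q"
  shows "(q v* V) \<bullet> xstar y V = 0"
proof -
  have "q v* V = q v* keep_rows Z V"
    by (metis assms(2) keep_entries_vector_matrix)
  then show ?thesis
    by (simp add: dot_lmul_matrix feasible[OF assms(1)])
qed

text \<open>Moving from \<open>V\<close> to \<open>V + t r x\<^sup>T\<close>, \<open>x\<close> the minimizer, makes the new minimizer orthogonal to
  \<open>x\<close>, so that the multiplier in direction \<open>r\<close> has to be \<open>1/t\<close>; this is unbounded for small \<open>t\<close>.\<close>

lemma xstar_eq_0_if_dependent:
  assumes V: "V \<in> U" and r: "keep_entries Z r = r" "r \<noteq> 0" "r v* V = 0"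
  shows "xstar y V = 0"
proof (rule ccontr)
  define x where "x = xstar y V"
  assume "xstar y V \<noteq> 0"
  then have x0: "x \<bullet> x \<noteq> 0" by (simp add: x_def)
  obtain t where t: "t > 0" "V + t *\<^sub>R outer_product r x \<in> U" "t * (CARD('k) * norm r) < 1"
    using open_small_step[OF open_U V] by blast
  define V' where "V' = V + t *\<^sub>R outer_product r x"
  have V': "V' \<in> U" using t by (simp add: V'_def)
  define x' where "x' = xstar y V'"
  have vm: "p v* V' = p v* V + (t * (p \<bullet> r)) *\<^sub>R x" for p
    by (simp add: V'_def vector_matrix_mult_add_rdistrib vector_matrix_scaleR vector_outer_product)
  \<comment> \<open>Since \<open>r v* V = 0\<close>, the vector \<open>r v* V'\<close> is a positive
    multiple of \<open>x\<close>.\<close>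
  have "(r v* V') \<bullet> x' = 0"
    using multiplier_orthogonal[OF V' r(1)] by (simp add: x'_def)
  then have orth: "x \<bullet> x' = 0"
    using t r by (simp add: vm)
  \<comment> \<open>The supports of \<open>c\<close> and \<open>r\<close> are disjoint, so the
    perturbation leaves \<open>c v* V\<close> unchanged.\<close>
  have cr: "c \<bullet> r = 0"
  proof -
    have "c $ i * r $ i = 0" for i
      using arg_cong[OF r(1), of "\<lambda>v. v $ i"] by (auto simp: keep_entries_def Z_def split: if_splits)
    then show ?thesis by (simp only: inner_vec_def inner_real_def sum.neutral_const)
  qed
  obtain q where q: "keep_entries Z q = q" "y = x + c v* V + q v* V"
    unfolding x_def by (rule multiplier[OF V])
  obtain q' where q': "keep_entries Z q' = q'" "norm q' \<le> CARD('k)" "y = x' + c v* V' + q' v* V'"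
    unfolding x'_def by (rule multiplier[OF V'])
  \<comment> \<open>Both optimality conditions are paired with \<open>x\<close>. At \<open>V\<close>
    the term with \<open>q\<close> drops out; at \<open>V'\<close> the minimizer drops out and only
    the rank one part of the term with \<open>q'\<close> is left.\<close>
  have "y \<bullet> x = x \<bullet> x + (c v* V) \<bullet> x"
    using multiplier_orthogonal[OF V q(1)]
    by (subst q(2)) (simp add: inner_add_left x_def)
  moreover have "y \<bullet> x = (c v* V) \<bullet> x + t * (q' \<bullet> r) * (x \<bullet> x)"
    using multiplier_orthogonal[OF V q'(1)] orth
    by (subst q'(3)) (simp add: vm inner_add_left cr inner_commute[of x' x] flip: x_def)
  ultimately have "t * (q' \<bullet> r) = 1"
    using x0 by simp
  moreover have "q' \<bullet> r \<le> CARD('k) * norm r"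
    using norm_cauchy_schwarz[of q' r] q'(2) by (meson mult_right_mono norm_ge_zero order_trans)
  then have "t * (q' \<bullet> r) \<le> t * (CARD('k) * norm r)"
    using t by (intro mult_left_mono) auto
  ultimately show False using t by simp
qed

text \<open>In the doubly rank deficient case the minimizer vanishes on all of the matrices
  \<open>W + t p u\<^sup>T\<close> below, since \<open>r\<close> remains in their left kernel.\<close>

lemma eq_0_if_rank_deficient:
  assumes W: "W \<in> U"
    and r: "keep_entries Z r = r" "r \<noteq> 0" "r v* W = 0"
    and u: "u \<noteq> 0" "keep_rows Z W *v u = 0"
  shows "y = 0"
proof -
  have x: "xstar y W = 0"
    by (rule xstar_eq_0_if_dependent[OF W r])
  then have c: "c = 0"
    using pattern_component[OF W] unfolding x by (simp add: vec_eq_iff)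
  then have "keep_rows Z W = W"
    by (simp add: Z_def keep_rows_def vec_eq_iff)
  then have u0: "W *v u = 0" using u by simp
  obtain q0 where q0: "y = q0 v* W"
    by (rule multiplier[OF W]) (use x c in auto)
  \<comment> \<open>The projection of \<open>q0\<close> onto the range of \<open>W\<close> still
    represents \<open>y\<close> and is in addition orthogonal to \<open>r\<close>.\<close>
  define p where "p = W *v (pinv W *v q0)"
  have yp: "y = p v* W" by (simp add: p_def vector_matrix_pinv q0)
  \<comment> \<open>No bound on \<open>t\<close> is wanted here, hence the trivial choice 0 for
    \<open>b\<close>.\<close>
  obtain t where t: "t > 0" "W + t *\<^sub>R outer_product p u \<in> U" "t * 0 < (1::real)"
    using open_small_step[OF open_U W] by blast
  define V where "V = W + t *\<^sub>R outer_product p u"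
  have V: "V \<in> U" using t by (simp add: V_def)
  have vm: "s v* V = s v* W + (t * (s \<bullet> p)) *\<^sub>R u" for s
    by (simp add: V_def vector_matrix_mult_add_rdistrib vector_matrix_scaleR vector_outer_product)
  have "r \<bullet> p = 0"
    using r(3) by (simp add: p_def dot_lmul_matrix[symmetric])
  then have "r v* V = 0" by (simp add: vm r)
  then have xV: "xstar y V = 0"
    by (rule xstar_eq_0_if_dependent[OF V r(1,2)])
  obtain q where q: "y = q v* V"
    by (rule multiplier[OF V]) (use xV c in auto)
  \<comment> \<open>As \<open>W *v u = 0\<close>, \<open>y\<close> is orthogonal to
    \<open>u\<close>, which forces \<open>q\<close> to be orthogonal to \<open>p\<close>. But
    \<open>q\<close> and \<open>p\<close> then both represent \<open>y\<close> through
    \<open>W\<close>, and as \<open>p\<close> lies in the range of \<open>W\<close>, this gives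
    \<open>p\<close> squared norm 0.\<close>
  have "t * (q \<bullet> p) * (u \<bullet> u) = (q v* V) \<bullet> u"
    by (simp add: vm inner_add_left dot_lmul_matrix u0)
  also have "\<dots> = 0"
    by (simp add: yp dot_lmul_matrix u0 flip: q)
  finally have qp: "q \<bullet> p = 0" using t u by simp
  then have "y = q v* W" using q by (simp add: vm)
  have "p \<bullet> p = (p v* W) \<bullet> (pinv W *v q0)"
    by (simp add: dot_lmul_matrix flip: p_def)
  also have "\<dots> = (q v* W) \<bullet> (pinv W *v q0)"
    using yp \<open>y = q v* W\<close> by simp
  also have "\<dots> = q \<bullet> p"
    by (simp add: dot_lmul_matrix flip: p_def)
  finally have "p = 0" using qp by simp
  then show ?thesis using yp by simp
qed

section \<open>The candidate derivative and the exact difference formula\<close>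

text \<open>Multipliers at \<open>W\<close> need not be unique. For \<open>W\<close> in
  \<open>U\<close>, \<open>(y - c v* W) v* pinv A\<close> is the projection of any of them onto the
  range of \<open>A\<close>, a canonical substitute for \<open>q(V)\<close> in the difference
  formula.\<close>

definition derivative_at :: "real^'n^'k \<Rightarrow> real^'n^'k \<Rightarrow> real^'n" where
  "derivative_at W H =
    (let A = keep_rows Z W in
     - (pinv A *v (keep_rows Z H *v xstar y W))
     - null_proj A *v (c v* H + ((y - c v* W) v* pinv A) v* keep_rows Z H))"

lemma bounded_linear_derivative_at: "bounded_linear (derivative_at W)"
proof -
  have "linear (derivative_at W)"
    unfolding derivative_at_def Let_def
    by (rule linearI)
      (simp_all add: linear_add[OF linear_keep_rows] linear_scale[OF linear_keep_rows]
        matrix_vector_mult_add_rdistrib vector_matrix_mult_add_rdistrib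
        vector_matrix_scaleR matrix_scaleR_vector matrix_vector_right_distrib
        matrix_vector_mult_scaleR algebra_simps)
  then show ?thesis by (simp add: linear_linear)
qed

text \<open>The projector annihilates the term with \<open>q\<close> and fixes the minimizer, which
  lies in the nullspace.\<close>

lemma xstar_projection:
  assumes W: "W \<in> U"
  shows "xstar y W = null_proj (keep_rows Z W) *v (y - c v* W)"
proof -
  obtain q where q: "keep_entries Z q = q" "y = xstar y W + c v* W + q v* W"
    by (rule multiplier[OF W])
  have "q v* W = q v* keep_rows Z W"
    by (metis q(1) keep_entries_vector_matrix)
  then have "y - c v* W = xstar y W + q v* keep_rows Z W"
    using q(2) by (simp add: algebra_simps)
  then show ?thesis
    by (simp add: matrix_vector_right_distrib null_proj_vector_matrix)
      (simp add: null_proj_apply feasible[OF W])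
qed

text \<open>The projector belonging to \<open>W\<close> is applied to the optimality condition at
  \<open>V\<close>. It removes \<open>q v* A\<close>, and feasibility at \<open>V\<close> expresses
  \<open>A *v x'\<close> through the perturbation.\<close>

lemma xstar_difference:
  assumes W: "W \<in> U" and V: "V \<in> U"
    and q: "keep_entries Z q = q" "y = xstar y V + c v* V + q v* V"
  shows "xstar y V - xstar y W =
    - (pinv (keep_rows Z W) *v (keep_rows Z (V - W) *v xstar y V))
    - null_proj (keep_rows Z W) *v (c v* (V - W) + q v* keep_rows Z (V - W))"
proof -
  define A where "A = keep_rows Z W"
  define H where "H = V - W"
  define x' where "x' = xstar y V"
  have VH: "V = W + H" by (simp add: H_def)
  have kV: "keep_rows Z V = A + keep_rows Z H" by (simp add: VH A_def keep_rows_add)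
  have "(A + keep_rows Z H) *v x' = 0"
    using feasible[OF V] by (simp add: kV x'_def)
  then have "A *v x' = - (keep_rows Z H *v x')"
    by (simp add: matrix_vector_mult_add_rdistrib eq_neg_iff_add_eq_0)
  then have Px': "null_proj A *v x' = x' + pinv A *v (keep_rows Z H *v x')"
    by (simp add: null_proj_apply vec.neg)
  have "q v* V = q v* keep_rows Z V"
    by (metis q(1) keep_entries_vector_matrix)
  then have "y - c v* W = x' + (c v* H + q v* keep_rows Z H) + q v* A"
    using q(2) by (simp add: kV) (simp add: x'_def VH vector_matrix_mult_add_rdistrib algebra_simps)
  then have "xstar y W = null_proj A *v (x' + (c v* H + q v* keep_rows Z H) + q v* A)"
    using xstar_projection[OF W] by (simp add: A_def)
  also have "\<dots> = x' + pinv A *v (keep_rows Z H *v x')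
      + null_proj A *v (c v* H + q v* keep_rows Z H)"
    by (simp only: matrix_vector_right_distrib[of "null_proj A"] null_proj_vector_matrix Px')
      simp
  finally show ?thesis
    by (simp add: A_def H_def x'_def)
qed

section \<open>Lipschitz bounds and the quadratic remainder\<close>

lemma norm_xstar_difference_le:
  assumes W: "W \<in> U" and V: "V \<in> U"
  shows "norm (xstar y V - xstar y W) \<le> (norm (pinv (keep_rows Z W)) * norm y
    + norm (null_proj (keep_rows Z W)) * (norm c + CARD('k))) * norm (V - W)"
proof -
  let ?A = "keep_rows Z W" and ?H = "V - W"
  obtain q where q: "keep_entries Z q = q" "norm q \<le> CARD('k)" "y = xstar y V + c v* V + q v* V"
    by (rule multiplier[OF V])
  have "norm (pinv ?A *v (keep_rows Z ?H *v xstar y V)) \<le> norm (pinv ?A) * (norm ?H * norm y)"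
    by (intro order_trans[OF norm_matrix_vector_mult_le] mult_left_mono mult_mono
        norm_keep_rows_le norm_xstar_le) auto
  moreover have "norm (c v* ?H + q v* keep_rows Z ?H) \<le> norm ?H * norm c + norm ?H * CARD('k)"
    by (intro norm_triangle_mono norm_vector_matrix_mult_le
        order_trans[OF norm_vector_matrix_mult_le] mult_mono norm_keep_rows_le q) auto
  then have "norm (null_proj ?A *v (c v* ?H + q v* keep_rows Z ?H))
      \<le> norm (null_proj ?A) * (norm ?H * norm c + norm ?H * CARD('k))"
    by (intro order_trans[OF norm_matrix_vector_mult_le] mult_left_mono) auto
  ultimately show ?thesis
    unfolding xstar_difference[OF W V q(1,3)]
    using norm_triangle_ineq4[of "- (pinv ?A *v (keep_rows Z ?H *v xstar y V))"
        "null_proj ?A *v (c v* ?H + q v* keep_rows Z ?H)"]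
    by (simp add: algebra_simps)
qed

text \<open>Each remaining term is the perturbation applied to a difference, of minimizers or of
  multipliers, so Lipschitz bounds on these make it quadratic.\<close>

lemma xstar_remainder:
  assumes W: "W \<in> U" and V: "V \<in> U"
    and q: "keep_entries Z q = q" "y = xstar y V + c v* V + q v* V"
  shows "xstar y V - xstar y W - derivative_at W (V - W) =
    - (pinv (keep_rows Z W) *v (keep_rows Z (V - W) *v (xstar y V - xstar y W)))
    - null_proj (keep_rows Z W) *v
        ((q - (y - c v* W) v* pinv (keep_rows Z W)) v* keep_rows Z (V - W))"
  by (rule trans[OF arg_cong[OF xstar_difference[OF assms], of "\<lambda>u. u - derivative_at W (V - W)"]])
    (simp add: derivative_at_def Let_def matrix_vector_right_distrib
      matrix_vector_mult_diff_distrib vector_matrix_mult_diff_distrib)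

lemma norm_multiplier_difference_le:
  assumes W: "W \<in> U" and V: "V \<in> U"
    and q: "keep_entries Z q = q" "norm q \<le> CARD('k)" "y = xstar y V + c v* V + q v* V"
    and indep: "\<And>r. keep_entries Z r = r \<Longrightarrow> r v* W = 0 \<Longrightarrow> r = 0"
  shows "norm (q - (y - c v* W) v* pinv (keep_rows Z W)) \<le>
    norm (pinv (keep_rows Z W)) *
      (norm (xstar y V - xstar y W) + norm (V - W) * (norm c + CARD('k)))"
proof -
  define A where "A = keep_rows Z W"
  define H where "H = V - W"
  define d where "d = q - (y - c v* W) v* pinv A"
  have vmA: "p v* W = p v* A" if "keep_entries Z p = p" for p
    by (metis A_def that keep_entries_vector_matrix)
  obtain q0 where q0: "keep_entries Z q0 = q0" "y = xstar y W + c v* W + q0 v* W"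
    by (rule multiplier[OF W])
  then have z: "y - c v* W = xstar y W + q0 v* A"
    by (simp add: vmA[OF q0(1), symmetric] algebra_simps)
  have "xstar y W v* pinv A = 0"
    using feasible[OF W] by (intro vector_pinv_eq_0) (simp add: A_def)
  \<comment> \<open>The canonical multiplier is the projection of \<open>q0\<close>, as the
    minimizer contributes nothing.\<close>
  then have qs: "(y - c v* W) v* pinv A = A *v (pinv A *v q0)"
    unfolding z by (simp add: vector_matrix_left_distrib pinv_apply)
  have "q v* V = q v* keep_rows Z V"
    by (metis q(1) keep_entries_vector_matrix)
  then have qV: "q v* V = q v* A + q v* keep_rows Z H"
    by (simp add: A_def H_def flip: vector_matrix_mult_add_rdistrib keep_rows_add)
  have "c v* V = c v* W + c v* H"
    by (simp add: H_def flip: vector_matrix_mult_add_rdistrib)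
  then have "y - c v* W = xstar y V + c v* H + (q v* A + q v* keep_rows Z H)"
    using q(3) unfolding qV by (simp add: algebra_simps)
  from trans[OF this[symmetric] z]
  have "q v* A - q0 v* A = - (xstar y V - xstar y W) - (c v* H + q v* keep_rows Z H)"
    by (simp add: algebra_simps)
  moreover have dq: "d = q - A *v (pinv A *v q0)"
    by (simp only: d_def qs)
  then have "d v* A = q v* A - q0 v* A"
    by (simp add: vector_matrix_mult_diff_distrib vector_matrix_pinv)
  ultimately have "d v* A = - (xstar y V - xstar y W) - (c v* H + q v* keep_rows Z H)"
    by simp
  then have "norm (d v* A) \<le> norm (xstar y V - xstar y W) + norm (c v* H + q v* keep_rows Z H)"
    by (metis norm_minus_cancel norm_triangle_ineq4)
  moreover have "norm (c v* H + q v* keep_rows Z H) \<le> norm H * norm c + norm H * CARD('k)"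
    by (intro norm_triangle_mono norm_vector_matrix_mult_le
        order_trans[OF norm_vector_matrix_mult_le] mult_mono norm_keep_rows_le q) auto
  ultimately have dA: "norm (d v* A) \<le> norm (xstar y V - xstar y W) + norm H * (norm c + CARD('k))"
    by (simp add: distrib_left)
  have range_A: "keep_entries Z (A *v w) = A *v w" for w
    by (simp add: A_def keep_rows_matrix_vector keep_entries_idem)
  \<comment> \<open>Independence of the rows in \<open>Z\<close> makes \<open>A ** pinv A\<close>
    fix \<open>d\<close>, so \<open>d\<close> can be recovered from \<open>d v* A\<close>, which was
    bounded above.\<close>
  have "d - A *v (pinv A *v d) = 0"
  proof (rule indep)
    show supp: "keep_entries Z (d - A *v (pinv A *v d)) = d - A *v (pinv A *v d)"
      by (simp only: keep_entries_diff range_A dq q)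
    show "(d - A *v (pinv A *v d)) v* W = 0"
      unfolding vmA[OF supp] by (simp add: vector_matrix_mult_diff_distrib vector_matrix_pinv)
  qed
  then have "d = (d v* A) v* pinv A"
    unfolding pinv_apply(2) by (rule eq_iff_diff_eq_0[THEN iffD2])
  then have "norm d = norm ((d v* A) v* pinv A)"
    by (rule arg_cong)
  also have "\<dots> \<le> norm (pinv A) * norm (d v* A)"
    by (rule norm_vector_matrix_mult_le)
  also have "\<dots> \<le> norm (pinv A) * (norm (xstar y V - xstar y W) + norm H * (norm c + CARD('k)))"
    using dA by (rule mult_left_mono) simp
  finally show ?thesis
    by (simp add: d_def A_def H_def)
qed

lemma xstar_remainder_le:
  assumes W: "W \<in> U"
  shows "\<exists>K. \<forall>V\<in>U. norm (xstar y V - xstar y W - derivative_at W (V - W)) \<le> K * (norm (V - W))\<^sup>2"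
proof -
  define A where "A = keep_rows Z W"
  define N where "N = norm c + CARD('k)"
  define D where "D = norm (pinv A) * norm y + norm (null_proj A) * N"
  define E where "E = norm (pinv A) * (D + N)"
  have nonneg: "N \<ge> 0" "D \<ge> 0" "E \<ge> 0"
    by (simp_all add: N_def D_def E_def)
  have lip: "norm (xstar y V - xstar y W) \<le> D * norm (V - W)" if "V \<in> U" for V
    using norm_xstar_difference_le[OF W that] by (simp add: D_def N_def A_def)
  have first: "norm (pinv A *v (keep_rows Z (V - W) *v (xstar y V - xstar y W)))
      \<le> norm (pinv A) * (norm (V - W) * (D * norm (V - W)))" if "V \<in> U" for V
    by (intro order_trans[OF norm_matrix_vector_mult_le] mult_left_mono mult_mono
        norm_keep_rows_le lip that) auto
  \<comment> \<open>Independence of the rows in \<open>Z\<close> means that \<open>A\<close> is onto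
    the vectors supported on \<open>Z\<close>, hence the name of the second case.\<close>
  consider (injective) "\<And>u. A *v u = 0 \<Longrightarrow> u = 0"
    | (surjective) "\<And>r. keep_entries Z r = r \<Longrightarrow> r v* W = 0 \<Longrightarrow> r = 0"
    | (deficient) u r where "u \<noteq> 0" "A *v u = 0" "keep_entries Z r = r" "r v* W = 0" "r \<noteq> 0"
    by blast
  then show ?thesis
  proof cases
    case injective
    then have P: "null_proj A *v w = 0" for w
      using matrix_null_proj by blast
    have "norm (xstar y V - xstar y W - derivative_at W (V - W))
        \<le> (norm (pinv A) * D) * (norm (V - W))\<^sup>2" if V: "V \<in> U" for V
    proof -
      obtain q where q: "keep_entries Z q = q" "y = xstar y V + c v* V + q v* V"
        by (rule multiplier[OF V])
      show ?thesis
        unfolding xstar_remainder[OF W V q] A_def[symmetric] P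
        using first[OF V] by (simp add: power2_eq_square mult_ac)
    qed
    then show ?thesis by blast
  next
    case surjective
    have "norm (xstar y V - xstar y W - derivative_at W (V - W))
        \<le> (norm (pinv A) * D + norm (null_proj A) * E) * (norm (V - W))\<^sup>2" if V: "V \<in> U" for V
    proof -
      let ?H = "V - W"
      obtain q where q: "keep_entries Z q = q" "norm q \<le> CARD('k)"
          "y = xstar y V + c v* V + q v* V"
        by (rule multiplier[OF V])
      let ?d = "q - (y - c v* W) v* pinv A"
      have "norm ?d \<le> norm (pinv A) * (norm (xstar y V - xstar y W) + norm ?H * N)"
        using norm_multiplier_difference_le[OF W V q surjective] by (simp add: A_def N_def)
      also have "\<dots> \<le> norm (pinv A) * (D * norm ?H + norm ?H * N)"
        by (intro mult_left_mono add_right_mono lip V) auto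
      also have "\<dots> = E * norm ?H"
        by (simp add: E_def algebra_simps)
      finally have d: "norm ?d \<le> E * norm ?H" .
      have "norm (null_proj A *v (?d v* keep_rows Z ?H))
          \<le> norm (null_proj A) * (norm ?H * (E * norm ?H))"
        by (intro order_trans[OF norm_matrix_vector_mult_le] mult_left_mono
            order_trans[OF norm_vector_matrix_mult_le] mult_mono norm_keep_rows_le d) auto
      from add_mono[OF first[OF V] this]
      have "norm (pinv A *v (keep_rows Z ?H *v (xstar y V - xstar y W)))
            + norm (null_proj A *v (?d v* keep_rows Z ?H))
          \<le> norm (pinv A) * (norm ?H * (D * norm ?H)) + norm (null_proj A) * (norm ?H * (E * norm ?H))" .
      also have "\<dots> = (norm (pinv A) * D + norm (null_proj A) * E) * (norm ?H)\<^sup>2"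
        by (simp add: power2_eq_square algebra_simps)
      finally have "norm (pinv A *v (keep_rows Z ?H *v (xstar y V - xstar y W)))
            + norm (null_proj A *v (?d v* keep_rows Z ?H))
          \<le> (norm (pinv A) * D + norm (null_proj A) * E) * (norm ?H)\<^sup>2" .
      then show ?thesis
        unfolding xstar_remainder[OF W V q(1,3)] A_def[symmetric]
        by (intro order_trans[OF norm_triangle_ineq4]) (simp only: norm_minus_cancel)
    qed
    then show ?thesis by blast
  next
    case deficient
    then have y: "y = 0"
      using eq_0_if_rank_deficient[OF W] by (simp add: A_def)
    then have x: "xstar y V = 0" for V
      using norm_xstar_le[of y V] by simp
    then have "c = 0"
      using pattern_component[OF W] unfolding x by (simp add: vec_eq_iff)
    then have "derivative_at W H = 0" for H
      unfolding derivative_at_def Let_def unfolding x by (simp add: y)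
    then have "xstar y V - xstar y W - derivative_at W (V - W) = 0" for V
      by (simp add: x)
    then show ?thesis by (intro exI[of _ 0]) simp
  qed
qed

theorem xstar_has_derivative:
  assumes W: "W \<in> U"
  shows "(xstar y has_derivative derivative_at W) (at W)"
proof -
  obtain K where "\<And>V. V \<in> U \<Longrightarrow>
      norm (xstar y V - xstar y W - derivative_at W (V - W)) \<le> K * (norm (V - W))\<^sup>2"
    using xstar_remainder_le[OF W] by blast
  then show ?thesis
    by (rule has_derivative_quadratic_remainder[OF bounded_linear_derivative_at open_U W])
qed

end

theorem theorem2:
  fixes y :: "real^'n" and W :: "real^'n^'k" and U :: "(real^'n^'k) set"
    and I0 Ipm :: "'k set" and W0 Wpm :: "real^'n^'k" and s :: "real^'k" and P :: "real^'n^'n"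
  assumes "open U" and "W \<in> U"
    and "\<forall>V\<in>U. sign_pattern y V = sign_pattern y W"
    and "I0 = {i. sign_pattern y W $ i = 0}"
    and "Ipm = {i. sign_pattern y W $ i \<noteq> 0}"
    and "W0 = keep_rows I0 W"
    and "Wpm = keep_rows Ipm W"
    and "s = keep_entries Ipm (sign_pattern y W)"
    and "P = null_proj W0"
  shows "xstar y W = P *v (y - transpose Wpm *v s) \<and>
    xstar y differentiable (at W) \<and>
    (\<forall>dWpm. keep_rows Ipm dWpm = dWpm \<longrightarrow>
       frechet_derivative (xstar y) (at W) dWpm = - (P *v (transpose dWpm *v s))) \<and>
    (\<forall>dW0. keep_rows I0 dW0 = dW0 \<longrightarrow>
       (let C = pinv W0 ** dW0 ** P
        in frechet_derivative (xstar y) (at W) dW0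
             = - ((C + transpose C) *v (y - transpose Wpm *v s))))"
proof -
  interpret constant_sign_pattern y U "sign_pattern y W"
    using assms(1,3) by unfold_locales auto
  have Z: "Z = I0" using assms(4) by (simp add: Z_def)
  have s: "s = sign_pattern y W"
    using assms(5,8) by (auto simp: keep_entries_def vec_eq_iff)
  have sW: "s v* Wpm = s v* W"
  proof -
    have "keep_entries Ipm s = s"
      using assms(5) by (auto simp: s keep_entries_def vec_eq_iff)
    then show ?thesis
      using assms(7) by (metis keep_entries_vector_matrix)
  qed
  have x: "xstar y W = P *v (y - s v* W)"
    using xstar_projection[OF assms(2)] assms(6,9) by (simp add: Z s)
  have der: "(xstar y has_derivative derivative_at W) (at W)"
    by (rule xstar_has_derivative[OF assms(2)])
  have frechet: "frechet_derivative (xstar y) (at W) H = - (pinv W0 *v (keep_rows I0 H *v xstar y W))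
      - P *v (s v* H + ((y - s v* W) v* pinv W0) v* keep_rows I0 H)" for H
    by (simp add: frechet_derivative_at[OF der, symmetric] derivative_at_def Z s Let_def assms(6,9))
  \<comment> \<open>Such a perturbation has no zero rows of the pattern, which leaves only the term
    with \<open>s\<close>.\<close>
  have "frechet_derivative (xstar y) (at W) H = - (P *v (s v* H))" if "keep_rows Ipm H = H" for H
  proof -
    have "keep_rows I0 H = 0"
      by (subst that[symmetric]) (auto simp: keep_rows_def vec_eq_iff assms(4,5))
    then show ?thesis by (simp add: frechet)
  qed
  moreover have "frechet_derivative (xstar y) (at W) H
      = - ((pinv W0 ** H ** P + transpose (pinv W0 ** H ** P)) *v (y - s v* W))"
    if H: "keep_rows I0 H = H" for H
  proof -
    have "keep_entries I0 s = 0"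
      by (auto simp: s keep_entries_def vec_eq_iff assms(4))
    then have "s v* H = 0"
      by (metis H keep_entries_vector_matrix vector_matrix_mult_0)
    \<comment> \<open>Symmetry of \<open>P\<close> turns the multiplier term into the one with
      \<open>transpose C\<close>; the projection formula for the minimizer turns the other into the
      one with \<open>C\<close>.\<close>
    moreover have "w v* P = P *v w" for w
      unfolding assms(9) by (rule vector_null_proj)
    ultimately show ?thesis
      by (simp add: frechet H x matrix_vector_mult_add_rdistrib matrix_vector_mul_assoc
          matrix_mul_assoc flip: vector_matrix_mul_assoc)
  qed
  moreover have "xstar y differentiable (at W)"
    using der by (rule differentiableI)
  ultimately show ?thesis
    using x unfolding Let_def transpose_matrix_vector sW by blast
qed

end
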